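(* Let $p>1$, $a>0$, and let $u_0\in C([0,a])$ with $u_0>0$ in $[0,a]$. Assume that $u(t,x)$ is a bounded (global) solution of $$ \begin{cases} u_t=u^p(u_{xx}+u-\bar u), & t>0,\ 0<x<a,\\ u_x(t,0)=u_x(t,a)=0, & t>0,\\ u(0,x)=u_0(x), & 0<x<a, \end{cases} $$ where $\bar u(t)=\frac1a\int_0^a u(t,x)\,dx$. Then $u(t,\cdot)$ converges to a steady state $u^*(\cdot)$ of this problem in $C([0,a])$ as $t\to+\infty$.
   Context: A solution means the positive solution, continuous up to $t=0$ and classical ($C^1$ in $t$, $C^2$ in $x$) for $t>0$. Positivity of $u_0$ guarantees positivity of the solution. A bounded solution is one that exists for all $t\ge0$ (maximal existence time $+\infty$) and satisfies $\sup_{t\ge 0}\|u(t,\cdot)\|_{C([0,a])}<+\infty$. A (nonnegative) steady state is a time-independent solution, i.e. a nonnegative function $u^*\in C^2([0,a])$ with $(u^* )^p\left((u^* )''+u^*-\overline{u^*}\right)=0$ in $(0,a)$ and $(u^* )'(0)=(u^* )'(a)=0$, where $\overline{u^*}=\frac1a\int_0^a u^*\,dx$; steady states may vanish at some points. *)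

theory Defs
  imports "HOL-Analysis.Analysis"
begin

definition mean :: "real \<Rightarrow> (real \<Rightarrow> real) \<Rightarrow> real" where
  "mean a f = (1 / a) * integral {0..a} f"

(* A solution on the whole time axis (maximal existence time infinity). Time is the first argument.
   Classical for t > 0 means: the derivatives u_t, u_x, u_xx (named ut, ux, uxx) exist and are
   jointly continuous on (0,oo) x [0,a], the space derivatives being one-sided at x = 0 and x = a.
   Values of u at t < 0 or x outside [0,a] play no role. *)
definition global_solution ::
  "real \<Rightarrow> real \<Rightarrow> (real \<Rightarrow> real) \<Rightarrow> (real \<Rightarrow> real \<Rightarrow> real) \<Rightarrow> bool" where
  "global_solution p a u0 u \<longleftrightarrow>
     continuous_on ({0..} \<times> {0..a}) (\<lambda>(t, x). u t x) \<and>
     (\<forall>t\<ge>0. \<forall>x\<in>{0..a}. u t x > 0) \<and>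
     (\<forall>x\<in>{0<..<a}. u 0 x = u0 x) \<and>
     (\<exists>ut ux uxx :: real \<Rightarrow> real \<Rightarrow> real.
        continuous_on ({0<..} \<times> {0..a}) (\<lambda>(t, x). ut t x) \<and>
        continuous_on ({0<..} \<times> {0..a}) (\<lambda>(t, x). ux t x) \<and>
        continuous_on ({0<..} \<times> {0..a}) (\<lambda>(t, x). uxx t x) \<and>
        (\<forall>t>0. \<forall>x\<in>{0..a}.
           ((\<lambda>s. u s x) has_real_derivative ut t x) (at t) \<and>
           ((\<lambda>y. u t y) has_real_derivative ux t x) (at x within {0..a}) \<and>
           ((\<lambda>y. ux t y) has_real_derivative uxx t x) (at x within {0..a})) \<and>
        (\<forall>t>0. \<forall>x\<in>{0<..<a}.
           ut t x = (u t x powr p) * (uxx t x + u t x - mean a (u t))) \<and>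
        (\<forall>t>0. ux t 0 = 0 \<and> ux t a = 0))"

(* 0 powr p = 0, so the equation is void at zeros of v. *)
definition steady_state :: "real \<Rightarrow> real \<Rightarrow> (real \<Rightarrow> real) \<Rightarrow> bool" where
  "steady_state p a v \<longleftrightarrow>
     (\<forall>x\<in>{0..a}. v x \<ge> 0) \<and>
     (\<exists>v' v'' :: real \<Rightarrow> real.
        (\<forall>x\<in>{0..a}.
           (v has_real_derivative v' x) (at x within {0..a}) \<and>
           (v' has_real_derivative v'' x) (at x within {0..a})) \<and>
        continuous_on {0..a} v'' \<and>
        (\<forall>x\<in>{0<..<a}. (v x powr p) * (v'' x + v x - mean a v) = 0) \<and>
        v' 0 = 0 \<and> v' a = 0)"

end

theory Submission
  imports Defs
begin

text \<open>Put \<open>w = u powr (1 - p)\<close> and \<open>g = u\<^sub>x\<^sub>x + u - m\<close>, where \<open>m\<close> is the mean of \<open>u\<close>, so that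
  \<open>w\<^sub>t = (1 - p) g\<close>. In particular the integral of \<open>w\<close> is conserved. The energy
  \<open>E = (\<integral> u\<^sub>x\<^sup>2 - u\<^sup>2) / 2 + a m\<^sup>2 / 2\<close> decreases at the rate \<open>\<integral> u\<^sub>t g\<close>, which makes \<open>u(t, \<cdot>)\<close>
  equicontinuous and slowly varying in time.

  Testing \<open>w\<^sub>t = (1 - p) g\<close> with \<open>sin (x - y)\<close> on \<open>[0, x]\<close> gives
  \<open>d/dt \<integral> sin (x - y) w dy = (1 - p) D(t, x)\<close> with \<open>D = u - m - c cos x\<close> and \<open>c = u(t, 0) - m\<close>.
  The left-hand side is the derivative of a bounded function and \<open>D\<close> varies slowly, so
  \<open>D\<close> tends to zero. Testing with \<open>cos (a - y)\<close> on \<open>[0, a]\<close> gives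
  \<open>(1 - p) c sin a\<close>: either \<open>c\<close> tends to zero, or \<open>sin a = 0\<close> and \<open>\<integral> w cos\<close> is conserved too.

  Hence for two large times \<open>s\<close> and \<open>t\<close> the integral of \<open>(w(t) - w(s)) (u(s) - u(t))\<close> is small. As
  \<open>r powr (1 - p)\<close> is strictly decreasing and \<open>u\<close> is bounded, it controls the squared
  \<open>L\<^sup>2\<close>-distance of \<open>u(s)\<close> and \<open>u(t)\<close>. So \<open>u(t, \<cdot>)\<close> is Cauchy, and its limit has the form
  \<open>\<mu> + \<gamma> cos x\<close> with \<open>\<gamma> sin a = 0\<close>.\<close>


section \<open>Analytic tools: parameter integrals, interpolation, a Tauberian argument,
  powers\<close>

lemma continuous_on_slice:
  fixes f :: "real \<Rightarrow> real \<Rightarrow> real"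
  assumes "continuous_on (S \<times> X) (\<lambda>(t, x). f t x)" "t \<in> S"
  shows "continuous_on X (f t)"
proof -
  have "continuous_on X (\<lambda>x. case (t, x) of (t, x) \<Rightarrow> f t x)"
    by (rule continuous_on_compose2[OF assms(1)]) (use assms(2) in \<open>auto intro!: continuous_intros\<close>)
  then show ?thesis by simp
qed

lemma DERIV_integral_param:
  fixes f f' :: "real \<Rightarrow> real \<Rightarrow> real"
  assumes "\<And>s x. s > 0 \<Longrightarrow> x \<in> {0..b} \<Longrightarrow> ((\<lambda>s. f s x) has_real_derivative f' s x) (at s)"
    and "\<And>s. s > 0 \<Longrightarrow> continuous_on {0..b} (f s)"
    and "continuous_on ({0<..} \<times> {0..b}) (\<lambda>(s, x). f' s x)"
    and "t > 0"
  shows "((\<lambda>s. integral {0..b} (f s)) has_real_derivative integral {0..b} (f' t)) (at t)"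
proof -
  have "((\<lambda>s. integral (cbox 0 b) (f s)) has_real_derivative integral (cbox 0 b) (f' t))
    (at t within {0<..})"
    by (rule leibniz_rule_field_derivative)
      (use assms in \<open>auto intro: has_field_derivative_at_within integrable_continuous_real\<close>)
  then show ?thesis
    using at_within_open[of t "{0<..}"] assms(4) by simp
qed

text \<open>If \<open>\<bar>f x\<bar>\<close> were at least \<open>e\<close>, then
  \<open>\<bar>f\<bar>\<close> would be at least \<open>e / 2\<close> on an interval of length
  \<open>d / 2\<close> next to \<open>x\<close>, which alone would exhaust the allowed
  integral.\<close>

lemma abs_less_of_small_integral_square:
  fixes f :: "real \<Rightarrow> real"
  assumes f: "continuous_on {0..a} f" and x: "x \<in> {0..a}"
    and d: "0 < d" "d \<le> a" and e: "e > 0"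
    and mod: "\<And>y. y \<in> {0..a} \<Longrightarrow> \<bar>y - x\<bar> \<le> d \<Longrightarrow> \<bar>f y - f x\<bar> \<le> e / 2"
    and small: "integral {0..a} (\<lambda>y. (f y)\<^sup>2) < d / 2 * (e / 2)\<^sup>2"
  shows "\<bar>f x\<bar> < e"
proof (rule ccontr)
  assume ge: "\<not> \<bar>f x\<bar> < e"
  \<comment> \<open>The interval lies on the side of \<open>x\<close> facing the centre; as
    \<open>d \<le> a\<close>, length \<open>d / 2\<close> always fits into
    \<open>{0..a}\<close>.\<close>
  define l where "l = (if x \<ge> a / 2 then x - d / 2 else x)"
  have l: "{l..l + d / 2} \<subseteq> {0..a}" "\<And>y. y \<in> {l..l + d / 2} \<Longrightarrow> \<bar>y - x\<bar> \<le> d"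
    using x d by (auto simp: l_def split: if_splits)
  have low: "(e / 2)\<^sup>2 \<le> (f y)\<^sup>2" if "y \<in> {l..l + d / 2}" for y
  proof -
    have "\<bar>f y - f x\<bar> \<le> e / 2" using mod l that by blast
    then have "e / 2 \<le> \<bar>f y\<bar>" using ge by linarith
    then show ?thesis using e by (metis abs_le_square_iff abs_of_pos half_gt_zero)
  qed
  have c2: "continuous_on {0..a} (\<lambda>y. (f y)\<^sup>2)" by (intro continuous_intros f)
  have "d / 2 * (e / 2)\<^sup>2 = integral {l..l + d / 2} (\<lambda>y. (e / 2)\<^sup>2)" using d by simp
  also have "\<dots> \<le> integral {l..l + d / 2} (\<lambda>y. (f y)\<^sup>2)"
    by (rule integral_le)
      (use low continuous_on_subset[OF c2 l(1)] in \<open>auto intro: integrable_continuous_real\<close>)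
  also have "\<dots> \<le> integral {0..a} (\<lambda>y. (f y)\<^sup>2)"
    by (rule integral_subset_le)
      (use l(1) c2 continuous_on_subset[OF c2 l(1)] in \<open>auto intro: integrable_continuous_real\<close>)
  finally show False using small by simp
qed

text \<open>Tauberian argument: in a window of length \<open>S\<close> the mean value theorem yields
  a time \<open>z\<close> where \<open>\<bar>k * A z i\<bar>\<close> is at most
  \<open>2 * C / S\<close>; slow variation carries this smallness back to the start of the window.
  \<open>S\<close> and \<open>T\<close> do not depend on \<open>i\<close>.\<close>

lemma slowly_varying_uniform_limit_0:
  fixes A B :: "real \<Rightarrow> 'i \<Rightarrow> real"
  assumes deriv: "\<And>t i. t > 0 \<Longrightarrow> i \<in> I \<Longrightarrow> ((\<lambda>t. B t i) has_real_derivative k * A t i) (at t)"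
    and k: "k \<noteq> 0" and bdd: "\<And>t i. t > 0 \<Longrightarrow> i \<in> I \<Longrightarrow> \<bar>B t i\<bar> \<le> C"
    and slow: "\<And>S e. S > 0 \<Longrightarrow> e > 0 \<Longrightarrow>
      \<exists>T>0. \<forall>t\<ge>T. \<forall>s\<in>{t..t+S}. \<forall>i\<in>I. \<bar>A s i - A t i\<bar> < e"
  shows "uniform_limit I A (\<lambda>_. 0) at_top"
proof (cases "I = {}")
  case False
  show ?thesis
  proof (rule uniform_limitI)
    fix e :: real assume e: "e > 0"
    have C: "C \<ge> 0" using bdd[of 1] False by fastforce
    \<comment> \<open>Solves \<open>2 * (C + 1) = S * \<bar>k\<bar> * (e / 2)\<close>; the
      \<open>+ 1\<close> keeps \<open>S\<close> positive and the estimate strict when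
      \<open>C = 0\<close>.\<close>
    define S where "S = 4 * (C + 1) / (\<bar>k\<bar> * e)"
    have S: "S > 0" using C e k by (simp add: S_def)
    obtain T where T: "T > 0"
      "\<And>t s i. t \<ge> T \<Longrightarrow> s \<in> {t..t+S} \<Longrightarrow> i \<in> I \<Longrightarrow> \<bar>A s i - A t i\<bar> < e / 2"
      using slow[OF S, of "e / 2"] e by auto
    have "dist (A t i) 0 < e" if t: "t \<ge> T" and i: "i \<in> I" for t i
    proof -
      obtain z where z: "t < z" "z < t + S" "B (t + S) i - B t i = (t + S - t) * (k * A z i)"
        using MVT2[of t "t + S" "\<lambda>s. B s i" "\<lambda>s. k * A s i"] S T(1) t deriv i by auto
      have "S * \<bar>k\<bar> * \<bar>A z i\<bar> = \<bar>B (t + S) i - B t i\<bar>" using z(3) S by (simp add: abs_mult)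
      also have "\<dots> < 2 * (C + 1)"
        using bdd[OF _ i, of t] bdd[OF _ i, of "t + S"] T(1) t S
        by (simp add: abs_real_def split: if_splits)
      also have "\<dots> = S * \<bar>k\<bar> * (e / 2)" using k e by (simp add: S_def field_simps)
      finally have "\<bar>A z i\<bar> < e / 2" using S k by (simp add: mult_less_cancel_left)
      moreover have "\<bar>A z i - A t i\<bar> < e / 2" using T(2)[OF t _ i, of z] z by auto
      ultimately show ?thesis unfolding dist_real_def by linarith
    qed
    then show "\<forall>\<^sub>F t in at_top. \<forall>i\<in>I. dist (A t i) 0 < e"
      using eventually_at_top_linorder by blast
  qed
qed simp

text \<open>Mean value theorem: the derivative of \<open>z powr (1 - p)\<close> has absolute value
  \<open>(p - 1) * z powr (- p)\<close>, which on \<open>(0, M]\<close> is smallest at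
  \<open>M\<close>.\<close>

lemma powr_monotone_lower:
  fixes r s :: real
  assumes p: "p > 1" and r: "0 < r" "r \<le> M" and s: "0 < s" "s \<le> M"
  shows "(p - 1) * M powr (- p) * (r - s)\<^sup>2 \<le> (r powr (1 - p) - s powr (1 - p)) * (s - r)"
proof -
  have *: "(p - 1) * M powr (- p) * (y - x)\<^sup>2 \<le> (x powr (1 - p) - y powr (1 - p)) * (y - x)"
    if xy: "0 < x" "x < y" "y \<le> M" for x y
  proof -
    have "((\<lambda>z. z powr (1 - p)) has_real_derivative (1 - p) * z powr (1 - p - 1)) (at z)"
      if "x \<le> z" for z
      using that xy(1) by (intro has_real_derivative_powr) linarith
    from MVT2[OF xy(2) this] obtain z where z: "x < z" "z < y"
      "y powr (1 - p) - x powr (1 - p) = (y - x) * ((1 - p) * z powr (1 - p - 1))"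
      by blast
    have "M powr (- p) \<le> z powr (- p)" using z xy p by (intro powr_mono2') auto
    then have "(p - 1) * M powr (- p) * (y - x)\<^sup>2 \<le> (p - 1) * z powr (- p) * (y - x)\<^sup>2"
      using p by (intro mult_right_mono mult_left_mono) auto
    also have "\<dots> = - (y powr (1 - p) - x powr (1 - p)) * (y - x)"
      by (simp add: z(3) power2_eq_square algebra_simps)
    finally show ?thesis by simp
  qed
  consider "r < s" | "s < r" | "r = s" by linarith
  then show ?thesis
  proof cases
    case 1 then show ?thesis using *[of r s] r s by (simp add: power2_commute)
  next
    case 2 then show ?thesis using *[of s r] r s by (simp add: algebra_simps)
  qed simp
qed

section \<open>The flow at positive times and the linearizing variable \<open>w\<close>\<close>

text \<open>\<open>pde\<close> is demanded at the end points too, so that it can be inserted under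
  integrals over \<open>{0..a}\<close>; for a given solution this follows by continuity.\<close>

locale bounded_flow =
  fixes p a M :: real and u ut ux uxx :: "real \<Rightarrow> real \<Rightarrow> real"
  assumes p: "p > 1" and a: "a > 0"
    and u_pos: "\<And>t x. t > 0 \<Longrightarrow> x \<in> {0..a} \<Longrightarrow> 0 < u t x"
    and u_le: "\<And>t x. t > 0 \<Longrightarrow> x \<in> {0..a} \<Longrightarrow> u t x \<le> M"
    and u_cont: "continuous_on ({0<..} \<times> {0..a}) (\<lambda>(t, x). u t x)"
    and ut_cont: "continuous_on ({0<..} \<times> {0..a}) (\<lambda>(t, x). ut t x)"
    and ux_cont: "continuous_on ({0<..} \<times> {0..a}) (\<lambda>(t, x). ux t x)"
    and uxx_cont: "continuous_on ({0<..} \<times> {0..a}) (\<lambda>(t, x). uxx t x)"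
    and ut: "\<And>t x. t > 0 \<Longrightarrow> x \<in> {0..a} \<Longrightarrow> ((\<lambda>s. u s x) has_real_derivative ut t x) (at t)"
    and ux: "\<And>t x. t > 0 \<Longrightarrow> x \<in> {0..a} \<Longrightarrow>
      (u t has_real_derivative ux t x) (at x within {0..a})"
    and uxx: "\<And>t x. t > 0 \<Longrightarrow> x \<in> {0..a} \<Longrightarrow>
      (ux t has_real_derivative uxx t x) (at x within {0..a})"
    and pde: "\<And>t x. t > 0 \<Longrightarrow> x \<in> {0..a} \<Longrightarrow>
      ut t x = u t x powr p * (uxx t x + u t x - mean a (u t))"
    and neumann: "\<And>t. t > 0 \<Longrightarrow> ux t 0 = 0" "\<And>t. t > 0 \<Longrightarrow> ux t a = 0"
begin

definition m where "m t = mean a (u t)"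
definition g where "g t x = uxx t x + u t x - m t"
definition w where "w t x = u t x powr (1 - p)"
definition E where
  "E t = 1 / 2 * integral {0..a} (\<lambda>x. (ux t x)\<^sup>2 - (u t x)\<^sup>2) + a / 2 * (m t)\<^sup>2"

lemmas slice = continuous_on_slice[where S = "{0<..}", simplified]
lemmas u_slice = slice[OF u_cont] and ut_slice = slice[OF ut_cont]
  and ux_slice = slice[OF ux_cont] and uxx_slice = slice[OF uxx_cont]

lemma M_pos: "M > 0"
  using u_pos[of 1 0] u_le[of 1 0] a by simp

lemma ut_eq: "t > 0 \<Longrightarrow> x \<in> {0..a} \<Longrightarrow> ut t x = u t x powr p * g t x"
  by (simp add: pde g_def m_def)

lemma has_integral_u: "t > 0 \<Longrightarrow> (u t has_integral a * m t) {0..a}"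
  using integrable_continuous_real[OF u_slice] a
  by (auto simp: m_def mean_def has_integral_integral)

lemma m_deriv:
  assumes "t > 0" shows "(m has_real_derivative mean a (ut t)) (at t)"
  unfolding m_def[abs_def] mean_def
  by (intro DERIV_cmult DERIV_integral_param) (use ut u_slice ut_cont assms in auto)

lemma m_cont: "continuous_on {0<..} m"
  using m_deriv by (meson DERIV_isCont continuous_at_imp_continuous_on greaterThan_iff)

lemma g_cont: "continuous_on ({0<..} \<times> {0..a}) (\<lambda>(t, x). g t x)"
proof -
  have "continuous_on ({0<..} \<times> {0..a}) (\<lambda>z. m (fst z))"
    by (rule continuous_on_compose2[OF m_cont]) (auto intro!: continuous_intros)
  then show ?thesis
    using u_cont uxx_cont unfolding g_def split_beta by (intro continuous_intros)
qed

lemmas g_slice = slice[OF g_cont]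

lemma w_cont: "continuous_on ({0<..} \<times> {0..a}) (\<lambda>(t, x). w t x)"
proof -
  have "\<forall>z\<in>{0<..} \<times> {0..a}. u (fst z) (snd z) \<noteq> 0" using u_pos by fastforce
  then show ?thesis
    using u_cont unfolding w_def split_beta by (intro continuous_intros) auto
qed

lemmas w_slice = slice[OF w_cont]

lemma w_nonneg: "w t x \<ge> 0"
  by (simp add: w_def)

text \<open>The factor \<open>u powr (- p)\<close> from the chain rule cancels the
  \<open>u powr p\<close> of the equation.\<close>

lemma w_deriv:
  assumes "t > 0" "x \<in> {0..a}"
  shows "((\<lambda>s. w s x) has_real_derivative (1 - p) * g t x) (at t)"
proof -
  have u: "u t x > 0" using u_pos assms by auto
  have "((\<lambda>s. w s x) has_real_derivative (1 - p) * u t x powr (1 - p - 1) * ut t x) (at t)"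
    unfolding w_def using u ut[OF assms] by (auto intro!: derivative_eq_intros)
  moreover have "u t x powr (- p) * u t x powr p = 1"
    using u by (simp add: powr_minus)
  ultimately show ?thesis
    by (simp add: ut_eq[OF assms] mult.assoc) (simp flip: mult.assoc)
qed

lemma w_moment_deriv:
  assumes x: "x \<in> {0..a}" and t: "t > 0" and k: "continuous_on {0..a} k"
  shows "((\<lambda>s. integral {0..x} (\<lambda>y. k y * w s y)) has_real_derivative
    (1 - p) * integral {0..x} (\<lambda>y. k y * g t y)) (at t)"
proof -
  have sub: "{0..x} \<subseteq> {0..a}" "{0<..} \<times> {0..x} \<subseteq> {0::real<..} \<times> {0..a}" using x by auto
  have k': "continuous_on {0..x} k" by (rule continuous_on_subset[OF k sub(1)])
  have "continuous_on ({0<..} \<times> {0..x}) (\<lambda>z::real\<times>real. k (snd z))"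
    by (rule continuous_on_compose2[OF k']) (auto intro!: continuous_intros)
  then have c: "continuous_on ({0<..} \<times> {0..x}) (\<lambda>(s, y). k y * ((1 - p) * g s y))"
    using continuous_on_subset[OF g_cont sub(2)] unfolding split_beta by (intro continuous_intros)
  have "((\<lambda>s. integral {0..x} (\<lambda>y. k y * w s y)) has_real_derivative
    integral {0..x} (\<lambda>y. k y * ((1 - p) * g t y))) (at t)"
  proof (rule DERIV_integral_param[OF _ _ c t])
    fix s :: real assume s: "s > 0"
    show "continuous_on {0..x} (\<lambda>y. k y * w s y)"
      by (intro continuous_intros k' continuous_on_subset[OF w_slice[OF s] sub(1)])
    fix y assume "y \<in> {0..x}"
    then show "((\<lambda>s. k y * w s y) has_real_derivative k y * ((1 - p) * g s y)) (at s)"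
      using sub s by (intro DERIV_cmult w_deriv) auto
  qed
  then show ?thesis by (simp add: mult.left_commute[of _ "1 - p"])
qed

definition c where "c t = u t 0 - m t"
text \<open>\<open>m t + c t * cos x\<close> solves \<open>v'' + v = m t\<close> with value
  \<open>u t 0\<close> and slope zero at \<open>0\<close>; \<open>D\<close> measures how far
  \<open>u t\<close> is from this profile.\<close>

definition D where "D t x = u t x - m t - c t * cos x"

section \<open>Testing \<open>g\<close> with constants, sines and cosines\<close>

lemma integral_g: "t > 0 \<Longrightarrow> integral {0..a} (g t) = 0"
proof -
  assume t: "t > 0"
  have "(uxx t has_integral ux t a - ux t 0) {0..a}"
    using a uxx[OF t] by (intro fundamental_theorem_of_calculus)
      (auto simp flip: has_real_derivative_iff_has_vector_derivative)
  then have "((\<lambda>x. uxx t x + u t x - m t) has_integral (ux t a - ux t 0) + a * m t - a * m t) {0..a}"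
    using has_integral_const_real[of "m t" 0 a] a
    by (intro has_integral_diff has_integral_add has_integral_u t) auto
  then show ?thesis by (simp add: g_def[abs_def] neumann t integral_unique)
qed

text \<open>\<open>sin (x - y)\<close> is the Duhamel kernel of \<open>v'' + v\<close>: integrated
  against \<open>g\<close> it recovers \<open>u - m\<close> at \<open>x\<close> up to the data at
  \<open>0\<close>, where the slope vanishes and only the value \<open>c t\<close> remains.\<close>

lemma integral_sin_g:
  assumes t: "t > 0" and x: "x \<in> {0..a}"
  shows "integral {0..x} (\<lambda>y. sin (x - y) * g t y) = D t x"
proof -
  let ?F = "\<lambda>y. sin (x - y) * ux t y + cos (x - y) * (u t y - m t)"
  have "((\<lambda>y. sin (x - y) * g t y) has_integral ?F x - ?F 0) {0..x}"
  proof (rule fundamental_theorem_of_calculus)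
    fix y assume y: "y \<in> {0..x}"
    have d: "(u t has_real_derivative ux t y) (at y within {0..x})"
      "(ux t has_real_derivative uxx t y) (at y within {0..x})"
      by (rule has_field_derivative_subset[OF ux[OF t]] has_field_derivative_subset[OF uxx[OF t]];
          use x y in auto)+
    show "(?F has_vector_derivative sin (x - y) * g t y) (at y within {0..x})"
      unfolding has_real_derivative_iff_has_vector_derivative[symmetric]
      by (auto intro!: derivative_eq_intros d simp: g_def algebra_simps)
  qed (use x in auto)
  then show ?thesis by (simp add: integral_unique D_def c_def neumann t algebra_simps)
qed

text \<open>The kernel solves \<open>k'' + k = 0\<close> and has slope zero at \<open>a\<close>. Two
  integrations by parts therefore leave no boundary term at \<open>a\<close>, and at
  \<open>0\<close> only the one with \<open>c t\<close>.\<close>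

lemma integral_cos_g:
  assumes t: "t > 0"
  shows "integral {0..a} (\<lambda>y. cos (a - y) * g t y) = sin a * c t"
proof -
  let ?F = "\<lambda>y. cos (a - y) * ux t y - sin (a - y) * (u t y - m t)"
  have "((\<lambda>y. cos (a - y) * g t y) has_integral ?F a - ?F 0) {0..a}"
  proof (rule fundamental_theorem_of_calculus)
    fix y assume y: "y \<in> {0..a}"
    show "(?F has_vector_derivative cos (a - y) * g t y) (at y within {0..a})"
      unfolding has_real_derivative_iff_has_vector_derivative[symmetric]
      by (auto intro!: derivative_eq_intros ux[OF t y] uxx[OF t y] simp: g_def algebra_simps)
  qed (use a in auto)
  then show ?thesis by (simp add: integral_unique neumann t c_def)
qed

section \<open>Energy identity and dissipation\<close>

text \<open>\<open>E\<close> is a quadratic form with gradient \<open>- g\<close>, so its increment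
  is half the pairing of the difference of the states with the sum of their gradients. In this form
  \<open>E\<close> can be differentiated in time without a mixed derivative of
  \<open>u\<close>.\<close>

lemma E_diff:
  assumes s: "s > 0" and t: "t > 0"
  shows "E s - E t = - (1 / 2) * integral {0..a} (\<lambda>x. (u s x - u t x) * (g s x + g t x))"
proof -
  let ?F = "\<lambda>x. (u s x - u t x) * (ux s x + ux t x)"
  let ?f = "\<lambda>x. (ux s x - ux t x) * (ux s x + ux t x) + (u s x - u t x) * (uxx s x + uxx t x)"
  let ?e = "\<lambda>t. integral {0..a} (\<lambda>x. (ux t x)\<^sup>2 - (u t x)\<^sup>2)"
  have 1: "(?f has_integral ?F a - ?F 0) {0..a}"
  proof (rule fundamental_theorem_of_calculus)
    fix y assume y: "y \<in> {0..a}"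
    show "(?F has_vector_derivative ?f y) (at y within {0..a})"
      unfolding has_real_derivative_iff_has_vector_derivative[symmetric]
      by (auto intro!: derivative_eq_intros ux[OF t y] uxx[OF t y] ux[OF s y] uxx[OF s y]
          simp: algebra_simps)
  qed (use a in auto)
  have 2: "((\<lambda>x. (ux t x)\<^sup>2 - (u t x)\<^sup>2) has_integral ?e t) {0..a}" if "t > 0" for t
    by (intro integrable_integral integrable_continuous_real continuous_intros ux_slice u_slice that)
  have "((\<lambda>x. ?f x - ((ux s x)\<^sup>2 - (u s x)\<^sup>2) + ((ux t x)\<^sup>2 - (u t x)\<^sup>2)
      - (m s + m t) * (u s x - u t x)) has_integral
      (?F a - ?F 0) - ?e s + ?e t - (m s + m t) * (a * m s - a * m t)) {0..a}"
    by (intro has_integral_diff has_integral_add has_integral_mult_right 1 2 s t has_integral_u)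
  moreover have "?f x - ((ux s x)\<^sup>2 - (u s x)\<^sup>2) + ((ux t x)\<^sup>2 - (u t x)\<^sup>2)
      - (m s + m t) * (u s x - u t x) = (u s x - u t x) * (g s x + g t x)" for x
    by (simp add: g_def algebra_simps power2_eq_square)
  ultimately have "integral {0..a} (\<lambda>x. (u s x - u t x) * (g s x + g t x)) =
      (?F a - ?F 0) - ?e s + ?e t - (m s + m t) * (a * m s - a * m t)"
    by (simp only: integral_unique)
  then show ?thesis
    by (simp add: neumann s t E_def field_simps power2_eq_square)
qed

lemma E_deriv:
  assumes t: "t > 0"
  shows "(E has_real_derivative - integral {0..a} (\<lambda>x. ut t x * g t x)) (at t)"
proof -
  \<comment> \<open>The difference quotient of \<open>u\<close> in time, written as the average of
    \<open>ut\<close> over the segment from \<open>t\<close> to \<open>s\<close>, so that it is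
    continuous across \<open>s = t\<close>.\<close>
  define h where "h s x = integral {0..1} (\<lambda>\<theta>. ut (t + \<theta> * (s - t)) x)" for s x
  have pos: "t + \<theta> * (s - t) > 0" if "s > 0" "\<theta> \<in> {0..1}" for s \<theta>
  proof -
    have "t + \<theta> * (s - t) = (1 - \<theta>) * t + \<theta> * s" by (simp add: algebra_simps)
    moreover have "\<theta> * s > 0 \<or> \<theta> = 0" "(1 - \<theta>) * t \<ge> 0"
      using that t by (auto simp: zero_less_mult_iff)
    ultimately show ?thesis using t by auto
  qed
  have h: "u s x - u t x = (s - t) * h s x" if s: "s > 0" and x: "x \<in> {0..a}" for s x
  proof -
    have "((\<lambda>\<theta>. (s - t) * ut (t + \<theta> * (s - t)) x) has_integral
        u (t + 1 * (s - t)) x - u (t + 0 * (s - t)) x) {0..1}"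
    proof (rule fundamental_theorem_of_calculus)
      fix \<theta> :: real assume th: "\<theta> \<in> {0..1}"
      have "((\<lambda>\<theta>. t + \<theta> * (s - t)) has_real_derivative (s - t)) (at \<theta> within {0..1})"
        by (auto intro!: derivative_eq_intros)
      from DERIV_chain2[OF ut[OF pos[OF s th] x] this]
      show "((\<lambda>\<theta>. u (t + \<theta> * (s - t)) x) has_vector_derivative (s - t) * ut (t + \<theta> * (s - t)) x)
        (at \<theta> within {0..1})"
        by (simp add: has_real_derivative_iff_has_vector_derivative[symmetric] mult.commute)
    qed simp
    from integral_unique[OF this] show ?thesis by (simp add: h_def)
  qed
  have "continuous_on (({0<..} \<times> {0..a}) \<times> cbox 0 1)
      (\<lambda>(z, \<theta>). ut (t + \<theta> * (fst z - t)) (snd z))"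
    using continuous_on_compose2[OF ut_cont, of "({0<..} \<times> {0..a}) \<times> cbox 0 1"
        "\<lambda>(z, \<theta>). (t + \<theta> * (fst z - t), snd z)"] pos
    by (fastforce intro!: continuous_intros simp: split_beta)
  then have hc: "continuous_on ({0<..} \<times> {0..a}) (\<lambda>z. h (fst z) (snd z))"
    using integral_continuous_on_param[where U = "{0<..} \<times> {0..a}" and a = 0 and b = "1::real"
        and f = "\<lambda>z \<theta>. ut (t + \<theta> * (fst z - t)) (snd z)"] by (simp add: h_def)
  \<comment> \<open>For \<open>s \<noteq> t\<close> this is the difference quotient of
    \<open>E\<close>; at \<open>s = t\<close> it is the continuous extension, hence the
    derivative.\<close>
  define Q where "Q s = - (1 / 2) * integral {0..a} (\<lambda>x. h s x * (g s x + g t x))" for s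
  have gt: "continuous_on ({0<..} \<times> {0..a}) (\<lambda>z::real\<times>real. g t (snd z))"
    by (rule continuous_on_compose2[OF g_slice[OF t]]) (auto intro!: continuous_intros)
  have "continuous_on ({0<..} \<times> cbox 0 a) (\<lambda>(s, x). h s x * (g s x + g t x))"
    using hc g_cont gt by (auto simp: split_beta intro!: continuous_intros)
  from integral_continuous_on_param[OF this] have "continuous_on {0<..} Q"
    unfolding Q_def by (auto intro!: continuous_intros)
  then have "isCont Q t" using t by (simp add: continuous_on_eq_continuous_at)
  then have "(Q \<longlongrightarrow> Q t) (at t)" by (simp add: isCont_def)
  moreover have ev: "\<forall>\<^sub>F s in at t. Q s = (E s - E t) / (s - t)"
  proof -
    have q: "Q s = (E s - E t) / (s - t)" if s: "s > 0" "s \<noteq> t" for s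
    proof -
      have "integral {0..a} (\<lambda>x. (u s x - u t x) * (g s x + g t x)) =
          integral {0..a} (\<lambda>x. (s - t) * (h s x * (g s x + g t x)))"
        by (rule integral_cong) (simp add: h s)
      then have "E s - E t = (s - t) * Q s" by (simp add: E_diff[OF s(1) t] Q_def)
      then show ?thesis using s by simp
    qed
    have "\<forall>\<^sub>F s in at t. s > 0 \<and> s \<noteq> t"
      using eventually_at_in_open[of "{0<..}" t] t by simp
    then show ?thesis by (rule eventually_mono) (simp add: q)
  qed
  moreover have "Q t = - integral {0..a} (\<lambda>x. ut t x * g t x)"
    by (simp add: Q_def h_def mult.left_commute flip: mult_2)
  ultimately show ?thesis
    unfolding has_field_derivative_iff by (simp add: tendsto_cong[OF ev])
qed

text \<open>The square of \<open>ut\<close> is \<open>u powr p\<close> times the nonnegative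
  \<open>ut * g\<close>, and \<open>u powr p\<close> is at most \<open>M powr p\<close>. Thus energy
  loss controls the speed of \<open>u\<close> in L2.\<close>

lemma dissipation:
  assumes t: "t > 0"
  shows "integral {0..a} (\<lambda>x. (ut t x)\<^sup>2) \<le> M powr p * integral {0..a} (\<lambda>x. ut t x * g t x)"
proof -
  have "integral {0..a} (\<lambda>x. (ut t x)\<^sup>2) \<le> integral {0..a} (\<lambda>x. M powr p * (ut t x * g t x))"
  proof (rule integral_le)
    fix x assume x: "x \<in> {0..a}"
    have "u t x powr p \<le> M powr p"
      using u_pos[OF t x] u_le[OF t x] p by (intro powr_mono2) auto
    then have "u t x powr p * (u t x powr p * (g t x)\<^sup>2) \<le> M powr p * (u t x powr p * (g t x)\<^sup>2)"
      by (intro mult_right_mono) auto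
    then show "(ut t x)\<^sup>2 \<le> M powr p * (ut t x * g t x)"
      by (simp add: ut_eq[OF t x] power2_eq_square algebra_simps)
  qed (intro integrable_continuous_real continuous_intros ut_slice g_slice t)+
  then show ?thesis by simp
qed

lemma integral_ut_g_nonneg: "t > 0 \<Longrightarrow> integral {0..a} (\<lambda>x. ut t x * g t x) \<ge> 0"
proof -
  assume t: "t > 0"
  have "0 \<le> integral {0..a} (\<lambda>x. (ut t x)\<^sup>2)"
    by (intro integral_nonneg integrable_continuous_real continuous_intros ut_slice t) auto
  then show ?thesis
    using dissipation[OF t] M_pos by (auto simp: zero_le_mult_iff dest: order_trans)
qed

lemma E_antimono:
  assumes "0 < s" "s \<le> t" shows "E t \<le> E s"
proof (rule DERIV_nonpos_imp_nonincreasing[OF assms(2)])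
  fix r assume "s \<le> r"
  then have "r > 0" using assms(1) by simp
  then show "\<exists>y. (E has_real_derivative y) (at r) \<and> y \<le> 0"
    using E_deriv integral_ut_g_nonneg by (meson neg_le_0_iff_le)
qed

lemma u_sq_le: "t > 0 \<Longrightarrow> x \<in> {0..a} \<Longrightarrow> (u t x)\<^sup>2 \<le> M\<^sup>2"
  using u_pos[of t x] u_le[of t x] by (intro power_mono) auto

lemma integral_ux_sq_le: "t > 0 \<Longrightarrow> integral {0..a} (\<lambda>x. (ux t x)\<^sup>2) \<le> 2 * E t + a * M\<^sup>2"
proof -
  assume t: "t > 0"
  have "integral {0..a} (\<lambda>x. (u t x)\<^sup>2) \<le> integral {0..a} (\<lambda>x. M\<^sup>2)"
    by (rule integral_le)
      (use u_sq_le t in \<open>auto intro!: integrable_continuous_real continuous_intros u_slice\<close>)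
  moreover have "integral {0..a} (\<lambda>x. (ux t x)\<^sup>2 - (u t x)\<^sup>2) =
      integral {0..a} (\<lambda>x. (ux t x)\<^sup>2) - integral {0..a} (\<lambda>x. (u t x)\<^sup>2)"
    by (intro integral_diff integrable_continuous_real continuous_intros ux_slice u_slice t)
  moreover have "a * (m t)\<^sup>2 \<ge> 0" using a by simp
  moreover have "2 * E t = integral {0..a} (\<lambda>x. (ux t x)\<^sup>2 - (u t x)\<^sup>2) + a * (m t)\<^sup>2"
    by (simp add: E_def field_simps)
  moreover have "integral {0..a} (\<lambda>x. M\<^sup>2) = a * M\<^sup>2" using a by simp
  ultimately show ?thesis by linarith
qed

text \<open>\<open>E\<close> is decreasing and, as \<open>u\<close> is bounded, bounded below; hence
  it converges.\<close>

lemma E_Cauchy: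
  assumes "d > 0"
  shows "\<exists>T\<ge>1. \<forall>t\<ge>T. \<forall>s\<ge>t. E t - E s < d"
proof -
  have "E t \<ge> - (a * M\<^sup>2 / 2)" if "t \<ge> 1" for t
  proof -
    have "0 \<le> integral {0..a} (\<lambda>x. (ux t x)\<^sup>2)"
      using that by (intro integral_nonneg integrable_continuous_real continuous_intros ux_slice) auto
    then show ?thesis using integral_ux_sq_le[of t] that by linarith
  qed
  then have bdd: "bdd_below (E ` {1..})" by (auto intro!: bdd_belowI2)
  have "Inf (E ` {1..}) < Inf (E ` {1..}) + d" using assms by simp
  then obtain T where T: "T \<ge> 1" "E T < Inf (E ` {1..}) + d"
    using cInf_lessD[of "E ` {1..}"] by fastforce
  have "E t - E s < d" if "t \<ge> T" "s \<ge> t" for s t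
  proof -
    have "E t \<le> E T" using T that by (intro E_antimono) auto
    moreover have "Inf (E ` {1..}) \<le> E s" using T that by (intro cInf_lower bdd) auto
    ultimately show ?thesis using T by linarith
  qed
  then show ?thesis using T(1) by blast
qed

section \<open>Equicontinuity in space, slow variation in time\<close>

text \<open>From time 1 on, the decreasing energy bounds the integral of the square of
  \<open>ux\<close> by \<open>R\<close>. Young's inequality with weight \<open>\<eta>\<close> then
  plays the role of Cauchy-Schwarz.\<close>

lemma equicontinuous:
  assumes e: "e > 0"
  shows "\<exists>d>0. d \<le> a \<and> (\<forall>t\<ge>1. \<forall>x\<in>{0..a}. \<forall>y\<in>{0..a}. \<bar>y - x\<bar> \<le> d \<longrightarrow> \<bar>u t y - u t x\<bar> \<le> e)"
proof -
  define R where "R = \<bar>2 * E 1 + a * M\<^sup>2\<bar> + 1"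
  \<comment> \<open>With this weight and \<open>y - x \<le> e / \<eta>\<close>, both terms of
    Young's bound, \<open>(y - x) * (\<eta> / 2)\<close> and \<open>R / (2 * \<eta>)\<close>, are at
    most \<open>e / 2\<close>.\<close>
  define \<eta> where "\<eta> = R / e"
  define d where "d = min a (e / \<eta>)"
  have pos: "R > 0" "\<eta> > 0" "d > 0" using e a by (auto simp: R_def \<eta>_def d_def)
  have ordered: "\<bar>u t y - u t x\<bar> \<le> e"
    if t: "t \<ge> 1" and xy: "0 \<le> x" "x \<le> y" "y \<le> a" "y - x \<le> d" for t x y
  proof -
    have t0: "t > 0" using t by simp
    have sub: "{x..y} \<subseteq> {0..a}" using xy by auto
    have cx: "continuous_on {x..y} (ux t)" by (rule continuous_on_subset[OF ux_slice[OF t0] sub])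
    have "(ux t has_integral u t y - u t x) {x..y}"
    proof (rule fundamental_theorem_of_calculus[OF xy(2)])
      fix z assume "z \<in> {x..y}"
      then show "(u t has_vector_derivative ux t z) (at z within {x..y})"
        unfolding has_real_derivative_iff_has_vector_derivative[symmetric]
        using sub by (intro has_field_derivative_subset[OF ux[OF t0] sub]) auto
    qed
    then have "\<bar>u t y - u t x\<bar> = norm (integral {x..y} (ux t))" by (simp add: integral_unique)
    also have "\<dots> \<le> integral {x..y} (\<lambda>z. \<eta> / 2 + (ux t z)\<^sup>2 / (2 * \<eta>))"
    proof (rule integral_norm_bound_integral)
      fix z
      have "0 \<le> (\<bar>ux t z\<bar> - \<eta>)\<^sup>2" by simp
      then have "2 * \<eta> * \<bar>ux t z\<bar> \<le> \<eta>\<^sup>2 + (ux t z)\<^sup>2"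
        by (simp add: power2_diff mult_ac)
      then show "norm (ux t z) \<le> \<eta> / 2 + (ux t z)\<^sup>2 / (2 * \<eta>)"
        using pos by (simp add: field_simps power2_eq_square)
    qed (use pos in \<open>auto intro!: integrable_continuous_real continuous_intros cx\<close>)
    also have "\<dots> = (y - x) * (\<eta> / 2) + integral {x..y} (\<lambda>z. (ux t z)\<^sup>2) / (2 * \<eta>)"
    proof -
      have "((\<lambda>z. \<eta> / 2 + (ux t z)\<^sup>2 / (2 * \<eta>)) has_integral
          (y - x) * (\<eta> / 2) + integral {x..y} (\<lambda>z. (ux t z)\<^sup>2) / (2 * \<eta>)) {x..y}"
        using has_integral_const_real[of "\<eta> / 2" x y] xy
        by (intro has_integral_add has_integral_divide integrable_integral
            integrable_continuous_real continuous_intros cx) auto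
      then show ?thesis by (rule integral_unique)
    qed
    also have "\<dots> \<le> e / \<eta> * (\<eta> / 2) + R / (2 * \<eta>)"
    proof -
      have "integral {x..y} (\<lambda>z. (ux t z)\<^sup>2) \<le> integral {0..a} (\<lambda>z. (ux t z)\<^sup>2)"
        by (rule integral_subset_le)
          (use sub cx ux_slice[OF t0] in \<open>auto intro!: integrable_continuous_real continuous_intros\<close>)
      also have "\<dots> \<le> R"
        using integral_ux_sq_le[OF t0] E_antimono[of 1 t] t by (simp add: R_def)
      finally show ?thesis
        using pos xy by (intro add_mono mult_right_mono divide_right_mono) (auto simp: d_def)
    qed
    also have "\<dots> = e" using pos e by (simp add: \<eta>_def)
    finally show ?thesis .
  qed
  have "\<bar>u t y - u t x\<bar> \<le> e"
    if "t \<ge> 1" "x \<in> {0..a}" "y \<in> {0..a}" "\<bar>y - x\<bar> \<le> d" for t x y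
    using ordered[of t x y] ordered[of t y x] that by (cases "x \<le> y") (auto simp: abs_minus_commute)
  then show ?thesis using pos by (intro exI[of _ d]) (auto simp: d_def)
qed

text \<open>The differences \<open>u s - u t\<close> inherit the common modulus of continuity, so
  L2-smallness forces uniform smallness with a \<open>\<delta>\<close> independent of the
  times.\<close>

lemma uniformly_close_of_L2_close:
  assumes e: "e > 0"
  shows "\<exists>\<delta>>0. \<forall>t\<ge>1. \<forall>s\<ge>1. integral {0..a} (\<lambda>x. (u s x - u t x)\<^sup>2) < \<delta> \<longrightarrow>
    (\<forall>x\<in>{0..a}. \<bar>u s x - u t x\<bar> < e)"
proof -
  obtain d where d: "d > 0" "d \<le> a"
    "\<And>t x y. t \<ge> 1 \<Longrightarrow> x \<in> {0..a} \<Longrightarrow> y \<in> {0..a} \<Longrightarrow> \<bar>y - x\<bar> \<le> d \<Longrightarrow> \<bar>u t y - u t x\<bar> \<le> e / 4"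
    using equicontinuous[of "e / 4"] e by auto
  have "\<bar>u s x - u t x\<bar> < e"
    if st: "t \<ge> 1" "s \<ge> 1" and x: "x \<in> {0..a}"
      and I: "integral {0..a} (\<lambda>x. (u s x - u t x)\<^sup>2) < d / 2 * (e / 2)\<^sup>2" for s t x
  proof (rule abs_less_of_small_integral_square[OF _ x d(1,2) e _ I])
    show "continuous_on {0..a} (\<lambda>x. u s x - u t x)"
      using st by (intro continuous_intros u_slice) auto
    show "\<bar>u s y - u t y - (u s x - u t x)\<bar> \<le> e / 2" if "y \<in> {0..a}" "\<bar>y - x\<bar> \<le> d" for y
      using d(3)[OF st(1) x that] d(3)[OF st(2) x that] by linarith
  qed
  moreover have "d / 2 * (e / 2)\<^sup>2 > 0" using d e by simp
  ultimately show ?thesis by blast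
qed

text \<open>Young's inequality splits the growth rate of the squared distance into a term bounded by
  \<open>\<eta> * a * M\<^sup>2\<close> and the integral of the square of \<open>ut\<close> over
  \<open>\<eta>\<close>; the latter is paid for by the energy loss.\<close>

lemma L2_distance_le:
  assumes t: "0 < t" "t \<le> s" and \<eta>: "\<eta> > 0"
  shows "integral {0..a} (\<lambda>x. (u s x - u t x)\<^sup>2) \<le> \<eta> * a * M\<^sup>2 * (s - t) + M powr p / \<eta> * (E t - E s)"
proof -
  \<comment> \<open>The claim amounts to \<open>?F s \<le> ?F t\<close>, because the distance
    integral vanishes at \<open>r = t\<close>.\<close>
  let ?F = "\<lambda>r. integral {0..a} (\<lambda>x. (u r x - u t x)\<^sup>2) - \<eta> * a * M\<^sup>2 * r + M powr p / \<eta> * E r"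
  have ct: "continuous_on ({0<..} \<times> {0..a}) (\<lambda>z::real\<times>real. u t (snd z))"
    by (rule continuous_on_compose2[OF u_slice[OF t(1)]]) (auto intro!: continuous_intros)
  have "?F s \<le> ?F t"
  proof (rule DERIV_nonpos_imp_nonincreasing[OF t(2)])
    fix r assume "t \<le> r" "r \<le> s"
    then have r: "r > 0" using t by simp
    have c: "continuous_on {0..a} (\<lambda>x. 2 * (u r x - u t x) * ut r x)"
      by (intro continuous_intros u_slice ut_slice r t)
    have "((\<lambda>r. integral {0..a} (\<lambda>x. (u r x - u t x)\<^sup>2)) has_real_derivative
        integral {0..a} (\<lambda>x. 2 * (u r x - u t x) * ut r x)) (at r)"
    proof (rule DERIV_integral_param[OF _ _ _ r])
      fix q :: real assume q: "q > 0"
      show "continuous_on {0..a} (\<lambda>x. (u q x - u t x)\<^sup>2)"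
        by (intro continuous_intros u_slice q t)
      show "((\<lambda>r. (u r x - u t x)\<^sup>2) has_real_derivative 2 * (u q x - u t x) * ut q x) (at q)"
        if "x \<in> {0..a}" for x
        using ut[OF q that] by (auto intro!: derivative_eq_intros)
    next
      show "continuous_on ({0<..} \<times> {0..a}) (\<lambda>(q, x). 2 * (u q x - u t x) * ut q x)"
        using u_cont ut_cont ct unfolding split_beta by (intro continuous_intros)
    qed
    then have d: "(?F has_real_derivative integral {0..a} (\<lambda>x. 2 * (u r x - u t x) * ut r x)
        - \<eta> * a * M\<^sup>2 + M powr p / \<eta> * (- integral {0..a} (\<lambda>x. ut r x * g r x))) (at r)"
      by (intro DERIV_add DERIV_diff DERIV_cmult E_deriv r) (auto intro!: derivative_eq_intros)
    have le: "integral {0..a} (\<lambda>x. 2 * (u r x - u t x) * ut r x) \<le>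
        \<eta> * a * M\<^sup>2 + M powr p / \<eta> * integral {0..a} (\<lambda>x. ut r x * g r x)"
    proof -
      have "integral {0..a} (\<lambda>x. 2 * (u r x - u t x) * ut r x) \<le>
          integral {0..a} (\<lambda>x. \<eta> * M\<^sup>2 + (ut r x)\<^sup>2 / \<eta>)"
      proof (rule integral_le)
        fix x assume x: "x \<in> {0..a}"
        let ?f = "u r x - u t x" and ?k = "ut r x"
        have "\<bar>?f\<bar> \<le> \<bar>M\<bar>"
          using u_pos[OF r x] u_le[OF r x] u_pos[OF t(1) x] u_le[OF t(1) x] by (simp add: abs_real_def)
        then have "\<eta> * ?f\<^sup>2 \<le> \<eta> * M\<^sup>2" using \<eta> by (intro mult_left_mono) (auto simp: abs_le_square_iff)
        moreover have "0 \<le> (\<eta> * ?f - ?k)\<^sup>2 / \<eta>" using \<eta> by simp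
        moreover have "(\<eta> * ?f - ?k)\<^sup>2 / \<eta> = \<eta> * ?f\<^sup>2 + ?k\<^sup>2 / \<eta> - 2 * ?f * ?k"
          using \<eta> by (simp add: power2_eq_square field_simps)
        ultimately show "2 * ?f * ?k \<le> \<eta> * M\<^sup>2 + ?k\<^sup>2 / \<eta>" by linarith
      qed (use c \<eta> in \<open>auto intro!: integrable_continuous_real continuous_intros ut_slice r\<close>)
      also have "\<dots> = a * (\<eta> * M\<^sup>2) + integral {0..a} (\<lambda>x. (ut r x)\<^sup>2) / \<eta>"
      proof -
        have "((\<lambda>x. \<eta> * M\<^sup>2 + (ut r x)\<^sup>2 / \<eta>) has_integral
            a * (\<eta> * M\<^sup>2) + integral {0..a} (\<lambda>x. (ut r x)\<^sup>2) / \<eta>) {0..a}"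
          using has_integral_const_real[of "\<eta> * M\<^sup>2" 0 a] a
          by (intro has_integral_add has_integral_divide integrable_integral
              integrable_continuous_real continuous_intros ut_slice r) auto
        then show ?thesis by (rule integral_unique)
      qed
      also have "\<dots> \<le> a * (\<eta> * M\<^sup>2) + M powr p * integral {0..a} (\<lambda>x. ut r x * g r x) / \<eta>"
        using dissipation[OF r] \<eta> by (intro add_left_mono divide_right_mono) auto
      finally show ?thesis by (simp add: algebra_simps)
    qed
    show "\<exists>y. (?F has_real_derivative y) (at r) \<and> y \<le> 0"
      by (rule exI, rule conjI, rule d) (use le in simp)
  qed
  then show ?thesis by (simp add: algebra_simps)
qed

text \<open>In \<open>L2_distance_le\<close> a small \<open>\<eta>\<close> makes the term in the
  elapsed time at most \<open>\<delta> / 2\<close>; with \<open>\<eta>\<close> fixed, late energy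
  drops are small enough for the other half.\<close>

lemma slow_u:
  assumes S: "S > 0" and e: "e > 0"
  shows "\<exists>T\<ge>1. \<forall>t\<ge>T. \<forall>s\<in>{t..t+S}. \<forall>x\<in>{0..a}. \<bar>u s x - u t x\<bar> < e"
proof -
  obtain \<delta> where \<delta>: "\<delta> > 0" "\<And>s t x. t \<ge> 1 \<Longrightarrow> s \<ge> 1 \<Longrightarrow>
      integral {0..a} (\<lambda>x. (u s x - u t x)\<^sup>2) < \<delta> \<Longrightarrow> x \<in> {0..a} \<Longrightarrow> \<bar>u s x - u t x\<bar> < e"
    using uniformly_close_of_L2_close[OF e] by auto
  define \<eta> where "\<eta> = \<delta> / (2 * a * M\<^sup>2 * S)"
  have \<eta>: "\<eta> > 0" "\<eta> * a * M\<^sup>2 * S = \<delta> / 2"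
    using a M_pos S \<delta>(1) by (auto simp: \<eta>_def)
  have d: "\<delta> * \<eta> / (2 * M powr p) > 0" using \<delta>(1) \<eta>(1) M_pos by simp
  obtain T where T: "T \<ge> 1" "\<And>t s. t \<ge> T \<Longrightarrow> s \<ge> t \<Longrightarrow> E t - E s < \<delta> * \<eta> / (2 * M powr p)"
    using E_Cauchy[OF d] by auto
  have "\<bar>u s x - u t x\<bar> < e" if t: "t \<ge> T" and s: "s \<in> {t..t+S}" and x: "x \<in> {0..a}" for t s x
  proof (rule \<delta>(2)[OF _ _ _ x])
    have "integral {0..a} (\<lambda>x. (u s x - u t x)\<^sup>2) \<le>
        \<eta> * a * M\<^sup>2 * (s - t) + M powr p / \<eta> * (E t - E s)"
      using t s T(1) by (intro L2_distance_le \<eta>) auto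
    also have "\<dots> < \<eta> * a * M\<^sup>2 * S + M powr p / \<eta> * (\<delta> * \<eta> / (2 * M powr p))"
      using t s T(2)[of t s] \<eta>(1) M_pos a
      by (intro add_le_less_mono mult_left_mono mult_strict_left_mono) auto
    also have "\<dots> = \<delta>" using \<eta> M_pos by simp
    finally show "integral {0..a} (\<lambda>x. (u s x - u t x)\<^sup>2) < \<delta>" .
  qed (use t s T(1) in auto)
  then show ?thesis using T(1) by blast
qed

lemma mean_close:
  assumes "continuous_on {0..a} f" "continuous_on {0..a} h" "\<And>x. x \<in> {0..a} \<Longrightarrow> \<bar>f x - h x\<bar> \<le> e"
  shows "\<bar>mean a f - mean a h\<bar> \<le> e"
proof -
  have "\<bar>integral {0..a} f - integral {0..a} h\<bar> = norm (integral {0..a} (\<lambda>x. f x - h x))"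
    using assms by (simp add: integral_diff integrable_continuous_real)
  also have "\<dots> \<le> integral {0..a} (\<lambda>x. e)"
    using assms by (intro integral_norm_bound_integral integrable_continuous_real continuous_intros) auto
  finally have "\<bar>integral {0..a} f - integral {0..a} h\<bar> \<le> a * e" using a by simp
  then show ?thesis
    using a by (simp add: mean_def abs_mult pos_divide_le_eq mult.commute flip: diff_divide_distrib)
qed

lemma m_close:
  "\<lbrakk>s > 0; t > 0; \<And>x. x \<in> {0..a} \<Longrightarrow> \<bar>u s x - u t x\<bar> \<le> e\<rbrakk> \<Longrightarrow> \<bar>m s - m t\<bar> \<le> e"
  unfolding m_def by (intro mean_close u_slice)

lemma D_close:
  assumes "s > 0" "t > 0" "\<And>x. x \<in> {0..a} \<Longrightarrow> \<bar>u s x - u t x\<bar> \<le> e" "x \<in> {0..a}"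
  shows "\<bar>c s - c t\<bar> \<le> 2 * e" "\<bar>D s x - D t x\<bar> \<le> 4 * e"
proof -
  have m: "\<bar>m s - m t\<bar> \<le> e" using assms by (intro m_close)
  have 0: "\<bar>u s 0 - u t 0\<bar> \<le> e" "\<bar>u s x - u t x\<bar> \<le> e" using assms a by auto
  show c: "\<bar>c s - c t\<bar> \<le> 2 * e" using m 0 by (simp add: c_def)
  define q where "q = (c s - c t) * cos x"
  have "\<bar>q\<bar> \<le> \<bar>c s - c t\<bar> * 1"
    unfolding q_def abs_mult by (intro mult_left_mono) auto
  then have "\<bar>q\<bar> \<le> 2 * e" using c by simp
  moreover have "D s x - D t x = (u s x - u t x) - (m s - m t) - q"
    by (simp add: D_def q_def algebra_simps)
  ultimately show "\<bar>D s x - D t x\<bar> \<le> 4 * e" using m 0(2) by linarith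
qed

section \<open>Conserved moments of \<open>w\<close>, decay of \<open>D\<close> and
  \<open>c\<close>\<close>

text \<open>The reference time 1 is arbitrary: the total mass of \<open>w\<close> is the same at all
  positive times.\<close>

definition K where "K = integral {0..a} (w 1)"

lemma constant_moment:
  assumes k: "continuous_on {0..a} k" and z: "\<And>t. t > 0 \<Longrightarrow> integral {0..a} (\<lambda>y. k y * g t y) = 0"
    and st: "s > 0" "t > 0"
  shows "integral {0..a} (\<lambda>y. k y * w s y) = integral {0..a} (\<lambda>y. k y * w t y)"
proof -
  have "((\<lambda>s. integral {0..a} (\<lambda>y. k y * w s y)) has_real_derivative 0) (at r within {0<..})"
    if "r \<in> {0<..}" for r
    using w_moment_deriv[of a r k] a k z[of r] that by (auto intro: has_field_derivative_at_within)
  then obtain C where "\<And>r. r \<in> {0<..} \<Longrightarrow> integral {0..a} (\<lambda>y. k y * w r y) = C"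
    using has_field_derivative_zero_constant[of "{0<..}" "\<lambda>r. integral {0..a} (\<lambda>y. k y * w r y)"]
    by auto
  then show ?thesis using st by simp
qed

lemma w_mass: "t > 0 \<Longrightarrow> integral {0..a} (w t) = K"
  using constant_moment[of "\<lambda>_. 1" t 1] by (simp add: K_def integral_g)

text \<open>As \<open>w\<close> is nonnegative, its conserved mass dominates these moments. The
  bound is uniform in time even if \<open>u\<close> approaches zero somewhere and \<open>w\<close>
  becomes large there.\<close>

lemma w_moment_le:
  assumes t: "t > 0" and x: "x \<in> {0..a}" and k: "continuous_on {0..a} k" "\<And>y. \<bar>k y\<bar> \<le> 1"
  shows "\<bar>integral {0..x} (\<lambda>y. k y * w t y)\<bar> \<le> K"
proof -
  have sub: "{0..x} \<subseteq> {0..a}" using x by auto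
  note [continuous_intros] = continuous_on_subset[OF k(1) sub] continuous_on_subset[OF w_slice[OF t] sub]
  have "norm (integral {0..x} (\<lambda>y. k y * w t y)) \<le> integral {0..x} (w t)"
  proof (rule integral_norm_bound_integral)
    show "norm (k y * w t y) \<le> w t y" for y
      using mult_right_mono[OF k(2) w_nonneg, of y t y] w_nonneg by (simp add: abs_mult)
  qed (intro integrable_continuous_real continuous_intros)+
  also have "\<dots> \<le> integral {0..a} (w t)"
    using sub w_nonneg
    by (intro integral_subset_le integrable_continuous_real continuous_intros w_slice t) auto
  finally show ?thesis by (simp add: w_mass t)
qed

text \<open>The sine moments of \<open>w\<close> over \<open>{0..x}\<close> are bounded by
  \<open>K\<close> for all \<open>t\<close> and \<open>x\<close> and have derivative
  \<open>(1 - p) * D t x\<close>, so the Tauberian lemma applies uniformly in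
  \<open>x\<close>.\<close>

lemma D_tendsto: "uniform_limit {0..a} D (\<lambda>_. 0) at_top"
proof (rule slowly_varying_uniform_limit_0)
  show "((\<lambda>t. integral {0..x} (\<lambda>y. sin (x - y) * w t y)) has_real_derivative (1 - p) * D t x) (at t)"
    if "t > 0" "x \<in> {0..a}" for t x
    using w_moment_deriv[OF that(2,1), of "\<lambda>y. sin (x - y)"] integral_sin_g[OF that]
    by (simp add: continuous_intros)
  show "\<bar>integral {0..x} (\<lambda>y. sin (x - y) * w t y)\<bar> \<le> K" if "t > 0" "x \<in> {0..a}" for t x
    using that by (intro w_moment_le) (auto intro!: continuous_intros)
  fix S e :: real assume Se: "S > 0" "e > 0"
  obtain T where T: "T \<ge> 1" "\<And>t s x. t \<ge> T \<Longrightarrow> s \<in> {t..t+S} \<Longrightarrow> x \<in> {0..a} \<Longrightarrow> \<bar>u s x - u t x\<bar> < e / 8"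
    using slow_u[OF Se(1), of "e / 8"] Se(2) by auto
  have "\<bar>D s x - D t x\<bar> < e" if "t \<ge> T" "s \<in> {t..t+S}" "x \<in> {0..a}" for s t x
    using D_close(2)[OF _ _ less_imp_le[OF T(2)[OF that(1,2)]] that(3)] T(1) that Se(2) by simp
  then show "\<exists>T>0. \<forall>t\<ge>T. \<forall>s\<in>{t..t+S}. \<forall>x\<in>{0..a}. \<bar>D s x - D t x\<bar> < e"
    using T(1) by (intro exI[of _ T]) auto
qed (use p in auto)

lemma c_tendsto:
  assumes "sin a \<noteq> 0"
  shows "(c \<longlongrightarrow> 0) at_top"
proof -
  \<comment> \<open>A one-point index set makes the Tauberian lemma serve a scalar function; its
    factor is now \<open>(1 - p) * sin a\<close>, nonzero by assumption.\<close>
  have "uniform_limit {0::real} (\<lambda>t _. c t) (\<lambda>_. 0) at_top"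
  proof (rule slowly_varying_uniform_limit_0)
    show "((\<lambda>t. integral {0..a} (\<lambda>y. cos (a - y) * w t y)) has_real_derivative ((1 - p) * sin a) * c t) (at t)"
      if "t > 0" for t
      using w_moment_deriv[of a t "\<lambda>y. cos (a - y)"] integral_cos_g[OF that] that a
      by (simp add: continuous_intros mult.assoc)
    show "\<bar>integral {0..a} (\<lambda>y. cos (a - y) * w t y)\<bar> \<le> K" if "t > 0" for t
      using that a by (intro w_moment_le) (auto intro!: continuous_intros)
    fix S e :: real assume Se: "S > 0" "e > 0"
    obtain T where T: "T \<ge> 1" "\<And>t s x. t \<ge> T \<Longrightarrow> s \<in> {t..t+S} \<Longrightarrow> x \<in> {0..a} \<Longrightarrow> \<bar>u s x - u t x\<bar> < e / 8"
      using slow_u[OF Se(1), of "e / 8"] Se(2) by auto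
    have "\<bar>c s - c t\<bar> < e" if "t \<ge> T" "s \<in> {t..t+S}" for s t
      using D_close(1)[OF _ _ less_imp_le[OF T(2)[OF that]], of 0] T(1) that Se(2) a by simp
    then show "\<exists>T>0. \<forall>t\<ge>T. \<forall>s\<in>{t..t+S}. \<forall>x\<in>{0::real}. \<bar>c s - c t\<bar> < e"
      using T(1) by (intro exI[of _ T]) auto
  qed (use p assms in auto)
  then show ?thesis by (simp add: uniform_limit_singleton)
qed

text \<open>Here \<open>cos a\<close> is 1 or -1, so \<open>cos y\<close> is a multiple of
  \<open>cos (a - y)\<close>, whose pairing with \<open>g\<close> is
  \<open>sin a * c t = 0\<close>.\<close>

lemma cos_moment_constant:
  assumes "sin a = 0" "s > 0" "t > 0"
  shows "integral {0..a} (\<lambda>y. cos y * w s y) = integral {0..a} (\<lambda>y. cos y * w t y)"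
proof -
  have "cos a * cos a = 1" using sin_cos_squared_add3[of a] assms(1) by simp
  then have *: "cos y = cos a * cos (a - y)" for y
    by (simp add: cos_diff assms(1) flip: mult.assoc)
  show ?thesis
  proof (rule constant_moment[OF _ _ assms(2,3)])
    show "integral {0..a} (\<lambda>y. cos y * g t y) = 0" if "t > 0" for t
    proof -
      have "integral {0..a} (\<lambda>y. cos y * g t y) = integral {0..a} (\<lambda>y. cos a * (cos (a - y) * g t y))"
        using * by (intro integral_cong) (metis mult.assoc)
      then show ?thesis by (simp add: integral_cos_g[OF that] assms(1))
    qed
  qed (intro continuous_intros)
qed

text \<open>The pairing vanishes in the resonant case because the cosine moment is conserved,
  and otherwise because \<open>c\<close> tends to zero.\<close>
lemma cos_pairing_small:
  assumes "e > 0"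
  shows "\<exists>T\<ge>1. \<forall>t\<ge>T. \<forall>s\<ge>T. \<bar>(c s - c t) *
    (integral {0..a} (\<lambda>y. cos y * w t y) - integral {0..a} (\<lambda>y. cos y * w s y))\<bar> \<le> e"
proof (cases "sin a = 0")
  case True
  have "\<forall>t\<ge>1. \<forall>s\<ge>1. \<bar>(c s - c t) *
      (integral {0..a} (\<lambda>y. cos y * w t y) - integral {0..a} (\<lambda>y. cos y * w s y))\<bar> \<le> e"
  proof (intro allI impI)
    fix t s :: real assume "1 \<le> t" "1 \<le> s"
    then show "\<bar>(c s - c t) *
      (integral {0..a} (\<lambda>y. cos y * w t y) - integral {0..a} (\<lambda>y. cos y * w s y))\<bar> \<le> e"
      using cos_moment_constant[OF True, of t s] assms by simp
  qed
  then show ?thesis by blast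
next
  case False
  have K: "K \<ge> 0" using w_moment_le[of 1 0 "\<lambda>_. 0"] a by simp
  \<comment> \<open>\<open>\<bar>c s - c t\<bar>\<close> will be at most twice this number and the
    difference of the moments at most \<open>2 * (K + 1)\<close>; the product of the bounds is
    \<open>e\<close>.\<close>
  have "e / (4 * (K + 1)) > 0" using K assms by simp
  then have "\<forall>\<^sub>F t in at_top. dist (c t) 0 < e / (4 * (K + 1))"
    by (rule tendstoD[OF c_tendsto[OF False]])
  then obtain T where T: "\<And>t. t \<ge> T \<Longrightarrow> \<bar>c t\<bar> < e / (4 * (K + 1))"
    by (auto simp: eventually_at_top_linorder)
  have "\<bar>(c s - c t) *
      (integral {0..a} (\<lambda>y. cos y * w t y) - integral {0..a} (\<lambda>y. cos y * w s y))\<bar> \<le> e"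
    if st: "t \<ge> max 1 T" "s \<ge> max 1 T" for s t
  proof -
    have "\<bar>integral {0..a} (\<lambda>y. cos y * w r y)\<bar> \<le> K" if "r \<ge> 1" for r
      using that a by (intro w_moment_le) (auto intro!: continuous_intros)
    from this[of s] this[of t]
    have "\<bar>integral {0..a} (\<lambda>y. cos y * w t y) - integral {0..a} (\<lambda>y. cos y * w s y)\<bar> \<le> 2 * (K + 1)"
      using st by auto
    moreover have "\<bar>c s - c t\<bar> \<le> 2 * (e / (4 * (K + 1)))" using T[of s] T[of t] st by auto
    ultimately have "\<bar>c s - c t\<bar> *
      \<bar>integral {0..a} (\<lambda>y. cos y * w t y) - integral {0..a} (\<lambda>y. cos y * w s y)\<bar>
      \<le> 2 * (e / (4 * (K + 1))) * (2 * (K + 1))"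
      by (intro mult_mono) auto
    also have "\<dots> = e" using K by (simp add: field_simps)
    finally show ?thesis by (simp add: abs_mult)
  qed
  then show ?thesis by (intro exI[of _ "max 1 T"]) auto
qed

section \<open>Cauchy property in L2\<close>

lemma L2_Cauchy:
  assumes e: "e > 0"
  shows "\<exists>T\<ge>1. \<forall>t\<ge>T. \<forall>s\<ge>T. integral {0..a} (\<lambda>x. (u s x - u t x)\<^sup>2) < e"
proof -
  define \<kappa> where "\<kappa> = (p - 1) * M powr (- p)"
  have \<kappa>: "\<kappa> > 0" using p M_pos by (simp add: \<kappa>_def)
  have K: "K \<ge> 0" using w_moment_le[of 1 0 "\<lambda>_. 0"] a by simp
  \<comment> \<open>\<open>D s - D t\<close> is bounded by \<open>2 * d\<close> and
    \<open>w t + w s\<close> has integral \<open>2 * K\<close>, so the part with \<open>D\<close>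
    costs at most \<open>4 * d * K\<close>, less than half of \<open>\<kappa> * e\<close>. The
    cosine part gets the other half.\<close>
  define d where "d = \<kappa> * e / (16 * (K + 1))"
  have d: "d > 0" using \<kappa> e K by (simp add: d_def)
  have dK: "4 * d * K < \<kappa> * e / 2"
  proof -
    have "\<kappa> * e = d * (16 * (K + 1))"
      using K by (subst nonzero_divide_eq_eq[symmetric]) (auto simp: d_def)
    moreover have "4 * d * K < 8 * d * (K + 1)" using d K by (simp add: algebra_simps add_pos_nonneg)
    ultimately show ?thesis by (simp add: algebra_simps)
  qed
  obtain T1 where T1: "\<And>t x. t \<ge> T1 \<Longrightarrow> x \<in> {0..a} \<Longrightarrow> \<bar>D t x\<bar> < d"
    using uniform_limitD[OF D_tendsto d]
    unfolding eventually_at_top_linorder dist_real_def diff_0_right by metis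
  obtain T2 where T2: "T2 \<ge> 1" "\<And>t s. t \<ge> T2 \<Longrightarrow> s \<ge> T2 \<Longrightarrow> \<bar>(c s - c t) *
    (integral {0..a} (\<lambda>y. cos y * w t y) - integral {0..a} (\<lambda>y. cos y * w s y))\<bar> \<le> \<kappa> * e / 2"
    using cos_pairing_small[of "\<kappa> * e / 2"] \<kappa> e by auto
  have "integral {0..a} (\<lambda>x. (u s x - u t x)\<^sup>2) < e" if "t \<ge> max T1 T2" "s \<ge> max T1 T2" for s t
  proof -
    have st: "t > 0" "s > 0" "t \<ge> T1" "s \<ge> T1" "t \<ge> T2" "s \<ge> T2" using that T2(1) by auto
    have D_cont: "continuous_on {0..a} (D r)" if "r > 0" for r
      unfolding D_def[abs_def] by (intro continuous_intros u_slice that)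
    note [continuous_intros] = u_slice[OF st(1)] u_slice[OF st(2)] w_slice[OF st(1)] w_slice[OF st(2)]
      D_cont[OF st(1)] D_cont[OF st(2)]
    let ?c = "\<lambda>r. integral {0..a} (\<lambda>y. cos y * w r y)"
    let ?P = "integral {0..a} (\<lambda>x. (w t x - w s x) * (D s x - D t x))"
    have "\<kappa> * integral {0..a} (\<lambda>x. (u s x - u t x)\<^sup>2) = integral {0..a} (\<lambda>x. \<kappa> * (u t x - u s x)\<^sup>2)"
      by (simp add: power2_commute)
    also have "\<dots> \<le> integral {0..a} (\<lambda>x. (w t x - w s x) * (u s x - u t x))"
    proof (rule integral_le)
      show "\<kappa> * (u t x - u s x)\<^sup>2 \<le> (w t x - w s x) * (u s x - u t x)" if "x \<in> {0..a}" for x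
        unfolding \<kappa>_def w_def using powr_monotone_lower p u_pos u_le st that by blast
    qed (intro integrable_continuous_real continuous_intros)+
    \<comment> \<open>Splits \<open>u s - u t\<close> into the differences of \<open>D\<close>,
      \<open>m\<close> and \<open>c * cos\<close>; the part with \<open>m\<close> drops out because
      both masses equal \<open>K\<close>.\<close>
    also have "\<dots> = ?P + (m s - m t) * (K - K) + (c s - c t) * (?c t - ?c s)"
    proof -
      have w: "(w r has_integral K) {0..a}" "((\<lambda>y. cos y * w r y) has_integral ?c r) {0..a}"
        if "r > 0" for r
        using that by (auto simp: has_integral_iff w_mass
            intro!: integrable_continuous_real continuous_intros w_slice)
      have "((\<lambda>x. (w t x - w s x) * (D s x - D t x) + (m s - m t) * (w t x - w s x)
          + (c s - c t) * (cos x * w t x - cos x * w s x)) has_integral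
          ?P + (m s - m t) * (K - K) + (c s - c t) * (?c t - ?c s)) {0..a}"
        by (intro has_integral_add has_integral_mult_right has_integral_diff w st
            integrable_integral integrable_continuous_real continuous_intros)
      moreover have "(w t x - w s x) * (D s x - D t x) + (m s - m t) * (w t x - w s x)
          + (c s - c t) * (cos x * w t x - cos x * w s x) = (w t x - w s x) * (u s x - u t x)" for x
        by (simp add: D_def algebra_simps)
      ultimately show ?thesis by (simp only: integral_unique)
    qed
    also have "\<dots> \<le> 4 * d * K + \<kappa> * e / 2"
    proof -
      have "norm ?P \<le> integral {0..a} (\<lambda>x. 2 * d * (w t x + w s x))"
      proof (rule integral_norm_bound_integral)
        fix x assume x: "x \<in> {0..a}"
        have "\<bar>w t x - w s x\<bar> * \<bar>D s x - D t x\<bar> \<le> (w t x + w s x) * (2 * d)"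
          using T1[OF st(3) x] T1[OF st(4) x] w_nonneg[of t x] w_nonneg[of s x]
          by (intro mult_mono) auto
        then show "norm ((w t x - w s x) * (D s x - D t x)) \<le> 2 * d * (w t x + w s x)"
          by (simp add: abs_mult mult.commute)
      qed (intro integrable_continuous_real continuous_intros)+
      also have "\<dots> = 2 * d * (K + K)"
        using integral_add[OF integrable_continuous_real[OF w_slice[OF st(1)]]
          integrable_continuous_real[OF w_slice[OF st(2)]]] st by (simp add: w_mass)
      finally have "?P \<le> 4 * d * K" by simp
      then show ?thesis
        using add_mono[OF _ abs_le_D1[OF T2(2)[OF st(5,6)]], of ?P "4 * d * K"] by simp
    qed
    also have "\<dots> < \<kappa> * e" using dK by linarith
    finally show ?thesis using \<kappa> by simp
  qed
  then show ?thesis using T2(1) by (intro exI[of _ "max T1 T2"]) auto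
qed

section \<open>Convergence and identification of the limit\<close>

lemma convergence: "\<exists>v. steady_state p a v \<and> uniform_limit {0..a} u v at_top"
proof -
  have Cauchy: "\<exists>T\<ge>1. \<forall>t\<ge>T. \<forall>s\<ge>T. \<forall>x\<in>{0..a}. \<bar>u s x - u t x\<bar> < e" if e: "e > 0" for e
  proof -
    obtain \<delta> where \<delta>: "\<delta> > 0" "\<And>s t x. t \<ge> 1 \<Longrightarrow> s \<ge> 1 \<Longrightarrow>
        integral {0..a} (\<lambda>x. (u s x - u t x)\<^sup>2) < \<delta> \<Longrightarrow> x \<in> {0..a} \<Longrightarrow> \<bar>u s x - u t x\<bar> < e"
      using uniformly_close_of_L2_close[OF e] by auto
    from L2_Cauchy[OF \<delta>(1)] obtain T where T: "T \<ge> 1"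
      "\<And>s t. t \<ge> T \<Longrightarrow> s \<ge> T \<Longrightarrow> integral {0..a} (\<lambda>x. (u s x - u t x)\<^sup>2) < \<delta>" by auto
    have "\<bar>u s x - u t x\<bar> < e" if "t \<ge> T" "s \<ge> T" "x \<in> {0..a}" for s t x
      using \<delta>(2)[of t s x] T that by auto
    then show ?thesis using T(1) by blast
  qed
  \<comment> \<open>The limit is constructed along integer times; the Cauchy property in real time
    then extends the convergence to all times.\<close>
  have "uniformly_Cauchy_on {0..a} (\<lambda>n. u (real n))"
  proof (rule uniformly_Cauchy_onI)
    fix e :: real assume "e > 0"
    from Cauchy[OF this] obtain T where T:
      "\<And>s t x. t \<ge> T \<Longrightarrow> s \<ge> T \<Longrightarrow> x \<in> {0..a} \<Longrightarrow> \<bar>u s x - u t x\<bar> < e" by metis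
    have "dist (u (real i) x) (u (real j) x) < e"
      if "x \<in> {0..a}" "i \<ge> nat \<lceil>T\<rceil>" "j \<ge> nat \<lceil>T\<rceil>" for i j x
      using T[of "real j" "real i" x] that by (auto simp: dist_real_def)
    then show "\<exists>N. \<forall>x\<in>{0..a}. \<forall>i\<ge>N. \<forall>j\<ge>N. dist (u (real i) x) (u (real j) x) < e" by blast
  qed
  then obtain v where v: "uniform_limit {0..a} (\<lambda>n. u (real n)) v sequentially"
    using Cauchy_uniformly_convergent uniformly_convergent_on_def by blast
  have lim: "uniform_limit {0..a} u v at_top"
  proof (rule uniform_limitI)
    fix e :: real assume e: "e > 0"
    then obtain T where T: "\<And>s t x. t \<ge> T \<Longrightarrow> s \<ge> T \<Longrightarrow> x \<in> {0..a} \<Longrightarrow> \<bar>u s x - u t x\<bar> < e / 2"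
      using Cauchy[of "e / 2"] half_gt_zero by metis
    obtain N where N: "\<And>n x. n \<ge> N \<Longrightarrow> x \<in> {0..a} \<Longrightarrow> dist (u (real n) x) (v x) < e / 2"
      using uniform_limitD[OF v half_gt_zero[OF e]] unfolding eventually_sequentially by metis
    have "dist (u t x) (v x) < e" if "t \<ge> T" "x \<in> {0..a}" for t x
    proof -
      define n where "n = max N (nat \<lceil>T\<rceil>)"
      have "n \<ge> N" "real n \<ge> T" unfolding n_def by linarith+
      then have "\<bar>u t x - u (real n) x\<bar> < e / 2" "\<bar>u (real n) x - v x\<bar> < e / 2"
        using T[of "real n" t x] N[of n x] that by (auto simp: dist_real_def)
      then show ?thesis unfolding dist_real_def by linarith
    qed
    then show "\<forall>\<^sub>F t in at_top. \<forall>x\<in>{0..a}. dist (u t x) (v x) < e"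
      using eventually_at_top_linorder by blast
  qed
  have pointwise: "((\<lambda>t. u t x) \<longlongrightarrow> v x) at_top" if "x \<in> {0..a}" for x
    by (rule tendsto_uniform_limitI[OF lim that])
  have v_cont: "continuous_on {0..a} v"
    by (rule uniform_limit_theorem[OF _ lim])
      (auto intro!: eventually_mono[OF eventually_gt_at_top[of 0]] u_slice)
  have v_nonneg: "v x \<ge> 0" if "x \<in> {0..a}" for x
  proof (rule tendsto_lowerbound[OF pointwise[OF that]])
    show "\<forall>\<^sub>F t in at_top. 0 \<le> u t x"
      by (rule eventually_mono[OF eventually_gt_at_top[of 0]]) (use u_pos that in \<open>auto intro: less_imp_le\<close>)
  qed simp
  have m_lim: "(m \<longlongrightarrow> mean a v) at_top"
  proof (rule tendstoI)
    fix e :: real assume e: "e > 0"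
    have "\<forall>\<^sub>F t in at_top. t > 0 \<and> (\<forall>x\<in>{0..a}. dist (u t x) (v x) < e / 2)"
      using uniform_limitD[OF lim, of "e / 2"] e by (intro eventually_conj eventually_gt_at_top) auto
    then show "\<forall>\<^sub>F t in at_top. dist (m t) (mean a v) < e"
    proof (rule eventually_mono)
      fix t assume t: "t > 0 \<and> (\<forall>x\<in>{0..a}. dist (u t x) (v x) < e / 2)"
      then have "\<bar>mean a (u t) - mean a v\<bar> \<le> e / 2"
        by (intro mean_close u_slice v_cont) (auto simp: dist_real_def less_imp_le)
      then show "dist (m t) (mean a v) < e" using e by (simp add: m_def dist_real_def)
    qed
  qed
  define \<mu> where "\<mu> = mean a v"
  define \<gamma> where "\<gamma> = v 0 - \<mu>"
  have c_lim: "(c \<longlongrightarrow> \<gamma>) at_top"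
    unfolding c_def[abs_def] \<gamma>_def \<mu>_def using a by (intro tendsto_intros pointwise m_lim) auto
  have v_eq: "v x = \<mu> + \<gamma> * cos x" if x: "x \<in> {0..a}" for x
  proof -
    have "((\<lambda>t. D t x) \<longlongrightarrow> v x - \<mu> - \<gamma> * cos x) at_top"
      unfolding D_def \<mu>_def by (intro tendsto_intros pointwise x m_lim c_lim)
    moreover have "((\<lambda>t. D t x) \<longlongrightarrow> 0) at_top"
      by (rule tendsto_uniform_limitI[OF D_tendsto x])
    ultimately have "v x - \<mu> - \<gamma> * cos x = 0" using tendsto_unique trivial_limit_at_top_linorder by blast
    then show ?thesis by simp
  qed
  \<comment> \<open>If \<open>sin a\<close> is nonzero, \<open>c\<close> tends to zero and
    \<open>\<gamma> = 0\<close>. This is the Neumann condition of the limit at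
    \<open>a\<close>.\<close>
  have \<gamma>: "\<gamma> * sin a = 0"
    using tendsto_unique[OF _ c_lim c_tendsto] by auto
  \<comment> \<open>\<open>v\<close> is known only on \<open>{0..a}\<close>; \<open>V\<close>
    continues its formula to the whole line and can be differentiated directly.\<close>
  define V where "V x = \<mu> + \<gamma> * cos x" for x
  have "integral {0..a} V = integral {0..a} v"
    by (rule integral_cong) (simp add: v_eq V_def)
  then have mean_V: "mean a V = \<mu>" by (simp add: mean_def \<mu>_def)
  have "steady_state p a V"
    unfolding steady_state_def
  proof (intro conjI exI)
    show "\<forall>x\<in>{0..a}. V x \<ge> 0" using v_nonneg v_eq by (simp add: V_def)
    show "\<forall>x\<in>{0..a}. (V has_real_derivative - (\<gamma> * sin x)) (at x within {0..a}) \<and>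
        ((\<lambda>x. - (\<gamma> * sin x)) has_real_derivative - (\<gamma> * cos x)) (at x within {0..a})"
      unfolding V_def[abs_def] by (auto intro!: derivative_eq_intros)
    \<comment> \<open>The bracket itself vanishes, also at zeros of \<open>V\<close>, because the
      mean of \<open>V\<close> is \<open>\<mu>\<close>.\<close>
    show "\<forall>x\<in>{0<..<a}. V x powr p * (- (\<gamma> * cos x) + V x - mean a V) = 0"
      by (simp add: mean_V) (simp add: V_def)
  qed (use \<gamma> in \<open>auto intro!: continuous_intros\<close>)
  moreover have "uniform_limit {0..a} u V at_top"
    using lim by (rule uniform_limit_cong'[THEN iffD1, rotated 2]) (auto simp: v_eq V_def)
  ultimately show ?thesis by blast
qed

end

section \<open>From bounded global solutions to the locale\<close>

theorem theorem1p3: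
  fixes p a :: real and u0 :: "real \<Rightarrow> real" and u :: "real \<Rightarrow> real \<Rightarrow> real"
  assumes "p > 1" and "a > 0"
    and "continuous_on {0..a} u0" and "\<forall>x\<in>{0..a}. u0 x > 0"
    and "global_solution p a u0 u"
    and "bounded ((\<lambda>(t, x). u t x) ` ({0..} \<times> {0..a}))"
  shows "\<exists>v. steady_state p a v \<and> uniform_limit {0..a} u v at_top"
proof -
  obtain B where B: "\<And>t x. t \<ge> 0 \<Longrightarrow> x \<in> {0..a} \<Longrightarrow> \<bar>u t x\<bar> \<le> B"
    using assms(6) by (fastforce simp: bounded_iff)
  obtain ut ux uxx where sol: "continuous_on ({0<..} \<times> {0..a}) (\<lambda>(t, x). ut t x)"
    "continuous_on ({0<..} \<times> {0..a}) (\<lambda>(t, x). ux t x)"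
    "continuous_on ({0<..} \<times> {0..a}) (\<lambda>(t, x). uxx t x)"
    "\<forall>t>0. \<forall>x\<in>{0..a}. ((\<lambda>s. u s x) has_real_derivative ut t x) (at t) \<and>
      ((\<lambda>y. u t y) has_real_derivative ux t x) (at x within {0..a}) \<and>
      ((\<lambda>y. ux t y) has_real_derivative uxx t x) (at x within {0..a})"
    "\<forall>t>0. \<forall>x\<in>{0<..<a}. ut t x = (u t x powr p) * (uxx t x + u t x - mean a (u t))"
    "\<forall>t>0. ux t 0 = 0 \<and> ux t a = 0"
    using assms(5) unfolding global_solution_def by blast
  have u: "continuous_on ({0..} \<times> {0..a}) (\<lambda>(t, x). u t x)" "\<forall>t\<ge>0. \<forall>x\<in>{0..a}. u t x > 0"
    using assms(5) unfolding global_solution_def by blast+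
  have u': "continuous_on ({0<..} \<times> {0..a}) (\<lambda>(t, x). u t x)"
    by (rule continuous_on_subset[OF u(1)]) auto
  have pde: "ut t x = u t x powr p * (uxx t x + u t x - mean a (u t))"
    if t: "t > 0" and x: "x \<in> {0..a}" for t x
  proof -
    \<comment> \<open>The defect of the equation is continuous on \<open>{0..a}\<close> and zero in
      the open interval, hence zero at the end points as well.\<close>
    let ?f = "\<lambda>x. ut t x - u t x powr p * (uxx t x + u t x - mean a (u t))"
    have cl: "closure {0<..<a} = {0..a}" using assms(2) by simp
    have "t \<in> {0<..}" using t by simp
    note [continuous_intros] = continuous_on_slice[OF u' this] continuous_on_slice[OF sol(1) this]
      continuous_on_slice[OF sol(3) this]
    have "\<forall>x\<in>{0..a}. u t x \<noteq> 0" using u(2) t by (metis less_irrefl less_imp_le)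
    then have "continuous_on (closure {0<..<a}) ?f" unfolding cl by (intro continuous_intros) auto
    from continuous_constant_on_closure[OF this, of 0 x] show ?thesis
      using sol(5) t x cl by auto
  qed
  interpret bounded_flow p a B u ut ux uxx
    by unfold_locales (use assms(1,2) B u(2) u' sol pde in \<open>auto simp: abs_le_iff\<close>)
  show ?thesis by (rule convergence)
qed

end
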